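(* Let $j$ be a positive integer, let $K\ge 0$, and let $c^{(j)}\in l_\infty(\mathbb{Z})$ be such that $\|\Delta c^{(j)}\|_\infty\le K2^{-j}$. Let $\gamma\in l_1(\mathbb{Z})$, $\gamma\ne 0$, and define $c^{(\ell)}:=\gamma*(c^{(\ell+1)}\downarrow 2)$ for $0\le\ell\le j-1$. Then $$\|\Delta c^{(\ell)}\|_\infty\le K\,\|\gamma\|_1^{j}\cdot(2\|\gamma\|_1)^{-\ell},\qquad 0\le\ell\le j-1 .$$
   Context: Sequences are real-valued and indexed by $\mathbb{Z}$. The difference operator is $(\Delta c)_k:=c_{k+1}-c_k$; downsampling is $(c\downarrow 2)_k:=c_{2k}$; convolution of $\gamma\in l_1(\mathbb{Z})$ and $c\in l_\infty(\mathbb{Z})$ is $(\gamma*c)_k:=\sum_{\ell\in\mathbb{Z}}\gamma_\ell c_{k-\ell}$. $\|\cdot\|_1$ and $\|\cdot\|_\infty$ are the $l_1$ and $l_\infty$ norms. *)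

theory Defs
  imports "HOL-Analysis.Infinite_Sum" "HOL-Analysis.Elementary_Metric_Spaces"
begin

definition l1 :: "(int \<Rightarrow> real) set" where
  "l1 = {x. x abs_summable_on UNIV}"

definition linf :: "(int \<Rightarrow> real) set" where
  "linf = {x. bounded (range x)}"

definition l1_norm :: "(int \<Rightarrow> real) \<Rightarrow> real" where
  "l1_norm x = (\<Sum>\<^sub>\<infinity>k. \<bar>x k\<bar>)"

(* Meaningful only for members of linf: the supremum of an unbounded set of reals is unspecified. *)
definition linf_norm :: "(int \<Rightarrow> real) \<Rightarrow> real" where
  "linf_norm x = (SUP k. \<bar>x k\<bar>)"

definition diff_op :: "(int \<Rightarrow> real) \<Rightarrow> int \<Rightarrow> real" where
  "diff_op c k = c (k + 1) - c k"

definition downsample2 :: "(int \<Rightarrow> real) \<Rightarrow> int \<Rightarrow> real" where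
  "downsample2 c k = c (2 * k)"

(* For x in l1 and c in linf the sum converges absolutely. *)
definition seq_conv :: "(int \<Rightarrow> real) \<Rightarrow> (int \<Rightarrow> real) \<Rightarrow> int \<Rightarrow> real" where
  "seq_conv x c k = (\<Sum>\<^sub>\<infinity>l. x l * c (k - l))"

end

theory Submission
  imports Defs
begin

text \<open>
  One step of the recursion multiplies the size of the differences by at most
  \<open>2 \<parallel>\<gamma>\<parallel>\<^sub>1\<close>. Downsampling costs the factor 2: a difference of the downsampled sequence
  telescopes into two consecutive differences of the original one
  (\<open>abs_diff_op_downsample2_le\<close>). Convolution costs the factor \<open>\<parallel>\<gamma>\<parallel>\<^sub>1\<close>: it commutes with
  \<open>\<Delta>\<close> (\<open>diff_op_seq_conv\<close>), so Young's inequality (\<open>abs_seq_conv_le\<close>) applies to the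
  differences themselves. Descending from level \<open>j\<close> to level \<open>l\<close> takes \<open>j - l\<close> steps and
  turns the initial bound \<open>K 2\<^sup>-\<^sup>j\<close> into \<open>K 2\<^sup>-\<^sup>j (2 \<parallel>\<gamma>\<parallel>\<^sub>1)\<^sup>j\<^sup>-\<^sup>l\<close>, which is the claim
  because the powers of two indexed by \<open>j\<close> cancel.

  Boundedness is carried down the recursion together with the estimate: it guarantees that
  the series of the convolution converges, so that the convolution commutes with \<open>\<Delta>\<close>, and
  that the supremum norm of the differences bounds each of them.
\<close>

lemma linf_iff_bound: "x \<in> linf \<longleftrightarrow> (\<exists>B. \<forall>k. \<bar>x k\<bar> \<le> B)"
  by (auto simp: linf_def bounded_iff)

lemma abs_le_linf_norm:
  assumes "x \<in> linf"
  shows "\<bar>x k\<bar> \<le> linf_norm x"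
proof -
  have "bdd_above (range (\<lambda>k. \<bar>x k\<bar>))"
    using assms by (auto simp: linf_iff_bound bdd_above_def)
  then show ?thesis
    unfolding linf_norm_def by (rule cSUP_upper[OF UNIV_I])
qed

lemma linf_norm_le: "(\<And>k. \<bar>x k\<bar> \<le> B) \<Longrightarrow> linf_norm x \<le> B"
  unfolding linf_norm_def by (rule cSUP_least) auto

lemma l1_norm_pos:
  assumes "x \<in> l1" "x \<noteq> (\<lambda>_. 0)"
  shows "0 < l1_norm x"
proof -
  obtain k where "x k \<noteq> 0"
    using assms(2) by auto
  moreover have "(\<Sum>\<^sub>\<infinity>i\<in>{k}. \<bar>x i\<bar>) \<le> (\<Sum>\<^sub>\<infinity>i. \<bar>x i\<bar>)"
    using assms(1) by (intro infsum_mono2) (auto simp: l1_def)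
  ultimately show ?thesis
    by (simp add: l1_norm_def)
qed

lemma diff_op_in_linf:
  assumes "c \<in> linf"
  shows "diff_op c \<in> linf"
proof -
  have "\<bar>diff_op c k\<bar> \<le> 2 * linf_norm c" for k
    using abs_le_linf_norm[OF assms, of k] abs_le_linf_norm[OF assms, of "k + 1"]
    by (simp add: diff_op_def)
  then show ?thesis
    unfolding linf_iff_bound by blast
qed

lemma downsample2_in_linf: "c \<in> linf \<Longrightarrow> downsample2 c \<in> linf"
  by (auto simp: linf_iff_bound downsample2_def)

lemma abs_diff_op_downsample2_le:
  assumes "c \<in> linf"
  shows "\<bar>diff_op (downsample2 c) k\<bar> \<le> 2 * linf_norm (diff_op c)"
proof -
  have "diff_op (downsample2 c) k = diff_op c (2 * k + 1) + diff_op c (2 * k)"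
    by (simp add: diff_op_def downsample2_def algebra_simps)
  then show ?thesis
    using abs_le_linf_norm[OF diff_op_in_linf[OF assms], of "2 * k + 1"]
      abs_le_linf_norm[OF diff_op_in_linf[OF assms], of "2 * k"]
    by linarith
qed

lemma seq_conv_abs_summable:
  assumes "x \<in> l1" and "c \<in> linf"
  shows "(\<lambda>l. x l * c (k - l)) abs_summable_on UNIV"
proof (rule abs_summable_on_comparison_test)
  show "(\<lambda>l. x l * linf_norm c) abs_summable_on UNIV"
    using assms(1) by (simp add: l1_def abs_mult summable_on_cmult_left)
  show "norm (x l * c (k - l)) \<le> norm (x l * linf_norm c)" for l
    using abs_le_linf_norm[OF assms(2), of "k - l"]
    by (simp add: abs_mult mult_left_mono)
qed

text \<open>Young's inequality for an \<open>l\<^sub>1\<close> kernel and a bounded sequence.\<close>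

lemma abs_seq_conv_le:
  assumes "x \<in> l1" and bound: "\<And>k. \<bar>c k\<bar> \<le> B"
  shows "\<bar>seq_conv x c k\<bar> \<le> l1_norm x * B"
proof -
  have "c \<in> linf"
    using bound by (auto simp: linf_iff_bound)
  note summable = seq_conv_abs_summable[OF assms(1) this, of k]
  have "\<bar>seq_conv x c k\<bar> \<le> (\<Sum>\<^sub>\<infinity>l. norm (x l * c (k - l)))"
    unfolding seq_conv_def using norm_infsum_bound[OF summable] by simp
  also have "\<dots> \<le> (\<Sum>\<^sub>\<infinity>l. \<bar>x l\<bar> * B)"
    using assms(1)
    by (intro infsum_mono summable summable_on_cmult_left)
      (auto simp: l1_def abs_mult intro!: mult_left_mono bound)
  also have "\<dots> = l1_norm x * B"
    unfolding l1_norm_def by (rule infsum_cmult_left')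
  finally show ?thesis .
qed

lemma seq_conv_in_linf: "x \<in> l1 \<Longrightarrow> c \<in> linf \<Longrightarrow> seq_conv x c \<in> linf"
  unfolding linf_iff_bound using abs_seq_conv_le by blast

lemma diff_op_seq_conv:
  assumes "x \<in> l1" and "c \<in> linf"
  shows "diff_op (seq_conv x c) = seq_conv x (diff_op c)"
proof
  fix k
  have summable: "(\<lambda>l. x l * c (i - l)) summable_on UNIV" for i
    using seq_conv_abs_summable[OF assms] by (rule abs_summable_summable)
  have "diff_op (seq_conv x c) k = (\<Sum>\<^sub>\<infinity>l. x l * c (k + 1 - l) - x l * c (k - l))"
    unfolding diff_op_def seq_conv_def
    using infsum_add[OF summable[of "k + 1"] summable_on_uminus[THEN iffD2, OF summable[of k]]]
    by (simp add: infsum_uminus)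
  also have "\<dots> = seq_conv x (diff_op c) k"
    unfolding seq_conv_def diff_op_def by (simp add: algebra_simps)
  finally show "diff_op (seq_conv x c) k = seq_conv x (diff_op c) k" .
qed

lemma linf_norm_diff_op_seq_conv_downsample2_le:
  assumes "x \<in> l1" and "c \<in> linf"
  shows "linf_norm (diff_op (seq_conv x (downsample2 c))) \<le> 2 * l1_norm x * linf_norm (diff_op c)"
proof (rule linf_norm_le)
  fix k
  have "\<bar>seq_conv x (diff_op (downsample2 c)) k\<bar> \<le> l1_norm x * (2 * linf_norm (diff_op c))"
    using assms(1) abs_diff_op_downsample2_le[OF assms(2)] by (rule abs_seq_conv_le)
  then show "\<bar>diff_op (seq_conv x (downsample2 c)) k\<bar> \<le> 2 * l1_norm x * linf_norm (diff_op c)"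
    by (simp add: diff_op_seq_conv[OF assms(1) downsample2_in_linf[OF assms(2)]] algebra_simps)
qed

theorem theorem7:
  fixes j :: nat and K :: real
    and c :: "nat \<Rightarrow> int \<Rightarrow> real" and \<gamma> :: "int \<Rightarrow> real"
  assumes "j > 0"
    and "K \<ge> 0"
    and "c j \<in> linf"
    and "linf_norm (diff_op (c j)) \<le> K * 2 powi (- int j)"
    and "\<gamma> \<in> l1"
    and "\<gamma> \<noteq> (\<lambda>_. 0)"
    and "\<forall>l<j. c l = seq_conv \<gamma> (downsample2 (c (l + 1)))"
  shows "\<forall>l<j. linf_norm (diff_op (c l))
           \<le> K * l1_norm \<gamma> ^ j * (2 * l1_norm \<gamma>) powi (- int l)"
proof (intro allI impI)
  fix l assume "l < j"
  define g where "g = l1_norm \<gamma>"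
  have g_pos: "0 < g"
    unfolding g_def using assms(5,6) by (rule l1_norm_pos)
  define bnd where "bnd i = K * g ^ j * (2 * g) powi (- int i)" for i
  have bnd_Suc: "2 * g * bnd (Suc i) = bnd i" for i
    using g_pos unfolding bnd_def power_int_minus power_int_of_nat by (simp add: field_simps)
  have "c l \<in> linf \<and> linf_norm (diff_op (c l)) \<le> bnd l"
    using less_imp_le[OF \<open>l < j\<close>]
  proof (induction rule: inc_induct)
    case base
    have "bnd j = K * 2 powi (- int j)"
      using g_pos by (simp add: bnd_def power_int_minus field_simps)
    then show ?case
      using assms(3,4) by simp
  next
    case (step i)
    then have c_Suc: "c (Suc i) \<in> linf" and le_Suc: "linf_norm (diff_op (c (Suc i))) \<le> bnd (Suc i)"
      by auto
    have c_i: "c i = seq_conv \<gamma> (downsample2 (c (Suc i)))"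
      using assms(7) step.hyps by simp
    have "linf_norm (diff_op (c i)) \<le> 2 * g * linf_norm (diff_op (c (Suc i)))"
      unfolding c_i g_def using assms(5) c_Suc by (rule linf_norm_diff_op_seq_conv_downsample2_le)
    also have "\<dots> \<le> 2 * g * bnd (Suc i)"
      using g_pos le_Suc by (intro mult_left_mono) auto
    finally have "linf_norm (diff_op (c i)) \<le> bnd i"
      by (simp only: bnd_Suc)
    moreover have "c i \<in> linf"
      unfolding c_i using assms(5) c_Suc by (intro seq_conv_in_linf downsample2_in_linf)
    ultimately show ?case by simp
  qed
  then show "linf_norm (diff_op (c l)) \<le> K * l1_norm \<gamma> ^ j * (2 * l1_norm \<gamma>) powi (- int l)"
    by (simp add: bnd_def g_def)
qed

end
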